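(* Let $n\ge 2$ be an integer and let $\Gamma$ be a $C^2$ regular simple closed curve in the Euclidean plane. If $\Gamma$ satisfies $C(R)$ and $C_{2n}(D)$ for some $R,D>0$, then $\Gamma$ is a circle.
   Context: $\|\cdot\|$ is the Euclidean norm on $\mathbb{R}^2$. A curve is regular if it is $C^1$ with non-vanishing derivative; a $C^2$ regular simple closed curve is one admitting a closed (periodic) parametrization that is $C^2$ with nowhere vanishing derivative and injective on a period. A polygon $S$ is inscribed in $\Gamma$ at $x$ if all the vertices of $S$ lie on $\Gamma$ and one of them is $x$. Regular $m$-gons ($m\ge 3$) are the usual convex ones. Property $C_m(D)$ (for an integer $m\ge 3$ and $D>0$): for every $x\in\Gamma$ there is a unique regular $m$-gon with edges of length $D$ inscribed in $\Gamma$ at $x$. Property $C(R)$ (for $R>0$): for every $x\in\Gamma$ there is a unique $y(x)\in\Gamma$ with $\|x-y(x)\|=R$, and $\|x-z\|<R$ for every $z\in\Gamma$ with $z\neq y(x)$. *)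

theory Defs
  imports "HOL-Analysis.Analysis"
begin

text \<open>
  The Euclidean plane is modelled by \<^typ>\<open>complex\<close>, whose norm and distance are the Euclidean ones.
  Curves are identified with their traces.
\<close>

definition C2_regular_simple_closed_curve :: "complex set \<Rightarrow> bool" where
  "C2_regular_simple_closed_curve \<Gamma> \<longleftrightarrow>
    (\<exists>(\<gamma> :: real \<Rightarrow> complex) T. T > 0
      \<and> (\<forall>t. \<gamma> (t + T) = \<gamma> t)
      \<and> \<gamma> C1_differentiable_on UNIV
      \<and> (\<lambda>t. vector_derivative \<gamma> (at t)) C1_differentiable_on UNIV
      \<and> (\<forall>t. vector_derivative \<gamma> (at t) \<noteq> 0)
      \<and> inj_on \<gamma> {0..<T}
      \<and> \<Gamma> = range \<gamma>)"

text \<open>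
  A convex polygon is represented by its set of vertices, which determines it; polygons that differ
  only in the labelling of their vertices are thus equal. Below, \<open>c\<close> is the centre, \<open>c + v\<close> is one
  of the vertices, and consecutive vertices are obtained by rotation through \<open>2 * pi / m\<close>.
\<close>

definition regular_polygon :: "nat \<Rightarrow> real \<Rightarrow> complex set \<Rightarrow> bool" where
  "regular_polygon m D S \<longleftrightarrow>
    (\<exists>c v. v \<noteq> 0
      \<and> S = (\<lambda>k. c + v * cis (2 * pi * real k / real m)) ` {..<m}
      \<and> norm (v * cis (2 * pi / real m) - v) = D)"

definition inscribed_at :: "complex set \<Rightarrow> complex set \<Rightarrow> complex \<Rightarrow> bool" where
  "inscribed_at S \<Gamma> x \<longleftrightarrow> S \<subseteq> \<Gamma> \<and> x \<in> S"

definition property_C_polygon :: "nat \<Rightarrow> real \<Rightarrow> complex set \<Rightarrow> bool" where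
  "property_C_polygon m D \<Gamma> \<longleftrightarrow>
    (\<forall>x\<in>\<Gamma>. \<exists>!S. regular_polygon m D S \<and> inscribed_at S \<Gamma> x)"

definition property_C :: "real \<Rightarrow> complex set \<Rightarrow> bool" where
  "property_C R \<Gamma> \<longleftrightarrow>
    (\<forall>x\<in>\<Gamma>. \<exists>!y. y \<in> \<Gamma> \<and> norm (x - y) = R \<and> (\<forall>z\<in>\<Gamma>. z \<noteq> y \<longrightarrow> norm (x - z) < R))"

definition is_circle :: "complex set \<Rightarrow> bool" where
  "is_circle \<Gamma> \<longleftrightarrow> (\<exists>c r. r > 0 \<and> \<Gamma> = sphere c r)"

end

theory Submission imports Defs begin

text \<open>
  Send each point of \<open>\<Gamma>\<close> to its farthest point, and also to the vertex opposite to it in its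
  inscribed \<open>2n\<close>-gon. Both maps are continuous involutions of a circle without fixed points, and
  two such involutions agree somewhere: they lift to increasing functions of the parameter whose
  squares are the translation by one period, so neither lift can stay below the other
  (\<open>lift_of_closed_pairing\<close>, \<open>half_period_lifts_meet\<close>). The diameter of the polygons, which is the
  same at all points, therefore equals \<open>R\<close>; so opposite vertices are mutually farthest points
  at every point of \<open>\<Gamma>\<close>.

  Let \<open>c t\<close> be the centre of the polygon at the point with parameter \<open>t\<close>. As \<open>t\<close> varies, every
  vertex moves on \<open>\<Gamma>\<close>, and at each time its distance from the momentary position of the opposite
  vertex is maximal, so its velocity is orthogonal to the diagonal through it
  (\<open>velocity_orthogonal_at_farthest_point\<close>). The polygon keeps its size, so relative to the centre
  the velocity of a vertex is orthogonal to that diagonal too; hence so is the velocity of the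
  centre. As \<open>2n \<ge> 4\<close>, two adjacent vertices give independent diagonals, so the centre is at rest.
  The differentiability used here is where \<open>C\<^sup>2\<close> enters: the diagonal at a point of \<open>\<Gamma>\<close> is a normal
  of length \<open>R\<close>, and the normal is as smooth as \<open>\<gamma>'\<close> (\<open>continuous_normal_differentiable\<close>).

  So \<open>\<Gamma>\<close> lies on a circle of diameter \<open>R\<close>. It is connected and symmetric about the centre, which
  forces it to be the whole circle (\<open>symmetric_connected_subset_sphere\<close>).
\<close>

section \<open>Involutions of a closed curve and their lifts\<close>

lemma periodic_shift_of_int:
  fixes \<gamma> :: "real \<Rightarrow> 'a"
  assumes "\<And>t. \<gamma> (t + T) = \<gamma> t"
  shows "\<gamma> (t + of_int k * T) = \<gamma> t"
proof (induction k rule: int_induct[of _ 0])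
  case (step1 i)
  then show ?case using assms[of "t + of_int i * T"] by (simp add: algebra_simps)
next
  case (step2 i)
  then show ?case using assms[of "t + of_int (i - 1) * T"] by (simp add: algebra_simps)
qed simp

lemma periodic_attains_on_period:
  fixes \<gamma> :: "real \<Rightarrow> 'a"
  assumes "T > 0" "\<And>t. \<gamma> (t + T) = \<gamma> t" "p \<in> range \<gamma>"
  obtains s where "t \<le> s" "s < t + T" "\<gamma> s = p"
proof -
  obtain u where u: "p = \<gamma> u" using assms(3) by blast
  define s where "s = u + of_int (- \<lfloor>(u - t) / T\<rfloor>) * T"
  have "\<gamma> s = p" unfolding s_def u using periodic_shift_of_int[of \<gamma>] assms(2) by blast
  moreover have "t \<le> s" "s < t + T"
    using floor_divide_lower[OF assms(1), of "u - t"] floor_divide_upper[OF assms(1), of "u - t"]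
    by (simp_all add: s_def algebra_simps)
  ultimately show ?thesis using that by blast
qed

lemma simple_periodic_close_eq:
  fixes \<gamma> :: "real \<Rightarrow> 'a"
  assumes "T > 0" and per: "\<And>t. \<gamma> (t + T) = \<gamma> t" and inj: "inj_on \<gamma> {0..<T}"
    and eq: "\<gamma> a = \<gamma> b" and close: "\<bar>a - b\<bar> < T"
  shows "a = b"
proof -
  define red where "red u = u + of_int (- \<lfloor>u / T\<rfloor>) * T" for u
  have red: "red u \<in> {0..<T}" "\<gamma> (red u) = \<gamma> u" for u
  proof -
    show "red u \<in> {0..<T}"
      using floor_divide_lower[OF assms(1), of u] floor_divide_upper[OF assms(1), of u]
      by (simp add: red_def algebra_simps)
    show "\<gamma> (red u) = \<gamma> u" unfolding red_def using periodic_shift_of_int[of \<gamma>] per by blast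
  qed
  have "red a = red b" using inj_onD[OF inj] red eq by metis
  then have diff: "a - b = of_int (\<lfloor>a / T\<rfloor> - \<lfloor>b / T\<rfloor>) * T"
    by (simp add: red_def algebra_simps)
  have "\<bar>of_int (\<lfloor>a / T\<rfloor> - \<lfloor>b / T\<rfloor>) :: real\<bar> * T < 1 * T"
    using close diff assms(1) by (simp add: abs_mult)
  then have "\<bar>of_int (\<lfloor>a / T\<rfloor> - \<lfloor>b / T\<rfloor>) :: real\<bar> < 1"
    using assms(1) mult_less_cancel_right_pos by blast
  then have "\<lfloor>a / T\<rfloor> - \<lfloor>b / T\<rfloor> = 0" by linarith
  then show ?thesis using diff by simp
qed

text \<open>
  The relation \<open>E\<close> pairs each point of the curve with a different one. In the parameter, the
  partner of \<open>t\<close> has exactly one representative in the window from \<open>t\<close> to \<open>t + T\<close>, which defines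
  the lift pointwise; as the window is compact and \<open>E\<close> is closed, the lift is continuous by the
  closed graph theorem. Symmetry makes \<open>t + T\<close> the representative of the partner
  of \<open>f t\<close>.
\<close>

lemma lift_of_closed_pairing:
  fixes \<gamma> :: "real \<Rightarrow> 'a::t2_space"
  assumes T: "T > 0" and per: "\<And>t. \<gamma> (t + T) = \<gamma> t" and inj: "inj_on \<gamma> {0..<T}"
    and cont: "continuous_on UNIV \<gamma>"
    and closed: "closed {(x, y). E x y}"
    and sym: "\<And>x y. E x y \<Longrightarrow> E y x"
    and irrefl: "\<And>x. \<not> E x x"
    and unique: "\<And>x. x \<in> range \<gamma> \<Longrightarrow> \<exists>!y. y \<in> range \<gamma> \<and> E x y"
  obtains f :: "real \<Rightarrow> real"
  where "continuous_on UNIV f" "\<And>t. f (f t) = t + T" "\<And>t. E (\<gamma> t) (\<gamma> (f t))"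
proof -
  have ex1: "\<exists>!s. t \<le> s \<and> s \<le> t + T \<and> E (\<gamma> t) (\<gamma> s)" for t
  proof -
    obtain y where y: "y \<in> range \<gamma>" "E (\<gamma> t) y"
      and y_unique: "\<And>z. z \<in> range \<gamma> \<Longrightarrow> E (\<gamma> t) z \<Longrightarrow> z = y"
      using unique[OF rangeI, of t] by (elim ex1E) blast
    obtain s where s: "t \<le> s" "s < t + T" "\<gamma> s = y"
      using periodic_attains_on_period[OF T per y(1)] by blast
    show ?thesis
    proof (rule ex1I[of _ s])
      show "t \<le> s \<and> s \<le> t + T \<and> E (\<gamma> t) (\<gamma> s)" using s y by auto
    next
      fix u assume u: "t \<le> u \<and> u \<le> t + T \<and> E (\<gamma> t) (\<gamma> u)"
      then have "\<gamma> u = \<gamma> s" using y_unique[of "\<gamma> u"] s(3) by simp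
      moreover have "u \<noteq> t" using u irrefl by auto
      moreover have "s \<noteq> t" using y(2) s(3) irrefl by auto
      moreover have "u \<noteq> t + T" using u per[of t] irrefl by auto
      ultimately have "\<gamma> u = \<gamma> s" "\<bar>u - s\<bar> < T" using u s by auto
      then show "u = s" using simple_periodic_close_eq[OF T per inj] by blast
    qed
  qed
  define f where "f t = (THE s. t \<le> s \<and> s \<le> t + T \<and> E (\<gamma> t) (\<gamma> s))" for t
  have f: "t \<le> f t \<and> f t \<le> t + T \<and> E (\<gamma> t) (\<gamma> (f t))" for t
    unfolding f_def by (rule theI'[OF ex1])
  have f_eq: "f t = s" if "t \<le> s" "s \<le> t + T" "E (\<gamma> t) (\<gamma> s)" for t s
    using that unfolding f_def by (intro the1_equality[OF ex1]) simp
  have "isCont f a" for a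
  proof -
    let ?S = "{a - 1..a + 1}"
    have cl: "closed {z. E (\<gamma> (fst z)) (\<gamma> (snd z))}"
    proof -
      have "continuous_on UNIV (\<lambda>z::real \<times> real. (\<gamma> (fst z), \<gamma> (snd z)))"
        by (intro continuous_on_Pair continuous_on_compose2[OF cont] continuous_intros) auto
      then have "closed ((\<lambda>z::real \<times> real. (\<gamma> (fst z), \<gamma> (snd z))) -` {(x, y). E x y})"
        by (rule closed_vimage[OF closed])
      then show ?thesis by (simp add: vimage_def)
    qed
    have "(\<lambda>x. (x, f x)) ` ?S
        = (?S \<times> UNIV) \<inter> {z. fst z \<le> snd z} \<inter> {z. snd z \<le> fst z + T}
          \<inter> {z. E (\<gamma> (fst z)) (\<gamma> (snd z))}" (is "_ = ?G")
    proof (intro equalityI subsetI)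
      fix z assume "z \<in> ?G"
      then have "z = (fst z, f (fst z))" "fst z \<in> ?S"
        using f_eq[of "fst z" "snd z"] by (auto simp: prod_eq_iff)
      then show "z \<in> (\<lambda>x. (x, f x)) ` ?S" by blast
    qed (use f in auto)
    moreover have "closed ?G"
      by (intro closed_Int cl closed_Times closed_Collect_le continuous_intros)
    ultimately have "continuous_on ?S f"
    proof (intro continuous_from_closed_graph[where T = "{a - 1..a + 1 + T}"] funcsetI)
      fix x assume "x \<in> ?S"
      then show "f x \<in> {a - 1..a + 1 + T}" using f[of x] by auto
    qed auto
    then show ?thesis
      using continuous_on_interior[of ?S f a] by auto
  qed
  moreover have "f (f t) = t + T" for t
    using f[of t] sym by (intro f_eq) (auto simp: per)
  ultimately show ?thesis
    using f by (intro that[of f]) (auto intro: continuous_at_imp_continuous_on)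
qed

lemma half_period_lift_strict_mono:
  fixes f :: "real \<Rightarrow> real"
  assumes "T > 0" and cont: "continuous_on UNIV f" and half: "\<And>t. f (f t) = t + T"
  shows "strict_mono f"
proof -
  have "inj f" by (rule injI) (metis half add_right_cancel)
  then have "strict_mono f \<or> strict_antimono_on UNIV f"
    using injective_eq_monotone_map[of UNIV f] cont by auto
  moreover have "\<not> strict_antimono_on UNIV f"
  proof
    assume "strict_antimono_on UNIV f"
    then have "f (0 + T) < f 0" using \<open>T > 0\<close> by (auto simp: monotone_on_def)
    moreover have "f (0 + T) = f 0 + T" by (metis half)
    ultimately show False using \<open>T > 0\<close> by simp
  qed
  ultimately show ?thesis by blast
qed

text \<open>
  If the graphs do not cross, one lift stays below the other, and as both are increasing this
  survives squaring; but both squares are the translation by \<open>T\<close>.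
\<close>

lemma half_period_lifts_meet:
  fixes f g :: "real \<Rightarrow> real"
  assumes T: "T > 0"
    and f: "continuous_on UNIV f" "\<And>t. f (f t) = t + T"
    and g: "continuous_on UNIV g" "\<And>t. g (g t) = t + T"
  obtains t where "f t = g t"
proof -
  have no_gap: False
    if "\<And>t. p t < q t" "strict_mono p" "\<And>t. p (p t) = t + T" "\<And>t. q (q t) = t + T"
    for p q :: "real \<Rightarrow> real"
  proof -
    have "p (p 0) < p (q 0)" using that(1,2) by (simp add: strict_mono_less)
    also have "\<dots> < q (q 0)" using that(1) by simp
    finally show False using that(3,4) by simp
  qed
  have "\<exists>t. f t = g t"
  proof (rule ccontr)
    assume ne: "\<nexists>t. f t = g t"
    define d where "d t = f t - g t" for t
    have "continuous_on UNIV d" unfolding d_def using f g by (intro continuous_intros)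
    then have "connected (range d)" using connected_UNIV connected_continuous_image by blast
    moreover have "0 \<notin> range d" using ne by (auto simp: d_def)
    ultimately have "\<not> (d a \<le> 0 \<and> 0 \<le> d b)" for a b
      using connectedD_interval[of "range d" "d a" "d b" 0] by auto
    then have "(\<forall>t. d t < 0) \<or> (\<forall>t. d t > 0)" by (meson not_less)
    then show False
    proof
      assume "\<forall>t. d t < 0"
      then show False using no_gap[of f g] d_def f g half_period_lift_strict_mono[OF T f] by auto
    next
      assume "\<forall>t. d t > 0"
      then show False using no_gap[of g f] d_def f g half_period_lift_strict_mono[OF T g] by auto
    qed
  qed
  then show ?thesis using that by blast
qed

section \<open>Opposite vertices of an inscribed polygon\<close>

text \<open>
  The side length \<open>D\<close> enters through the diameter of the \<open>2n\<close>-gon. Since \<open>x\<close> and \<open>y\<close> determine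
  the centre, all vertices are expressed by \<open>x\<close> and \<open>y\<close>, so that the relation is closed whenever
  \<open>\<Gamma>\<close> is. The exponent ranges over all naturals, which repeats vertices but makes the exchange of
  \<open>x\<close> and \<open>y\<close> a shift by \<open>n\<close>.
\<close>

definition opposite_vertices :: "complex set \<Rightarrow> nat \<Rightarrow> real \<Rightarrow> complex \<Rightarrow> complex \<Rightarrow> bool" where
  "opposite_vertices \<Gamma> n D x y \<longleftrightarrow>
    norm (x - y) = 2 * D / norm (cis (pi / real n) - 1)
    \<and> (\<forall>k::nat. (x + y) / 2 + cis (pi / real n) ^ k * ((x - y) / 2) \<in> \<Gamma>)"

lemma cis_pi_div_power: "n > 0 \<Longrightarrow> cis (pi / real n) ^ n = -1"
  by (simp add: Complex.DeMoivre)

lemma Im_cis_pi_div_pos: "n \<ge> 2 \<Longrightarrow> Im (cis (pi / real n)) > 0"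
  by (auto intro!: sin_gt_zero simp: field_simps)

lemma opposite_vertices_sym:
  assumes "n > 0" "opposite_vertices \<Gamma> n D x y"
  shows "opposite_vertices \<Gamma> n D y x"
  unfolding opposite_vertices_def
proof (intro conjI allI)
  show "norm (y - x) = 2 * D / norm (cis (pi / real n) - 1)"
    using assms(2) by (simp add: opposite_vertices_def norm_minus_commute)
next
  fix k
  have "(x + y) / 2 + cis (pi / real n) ^ (k + n) * ((x - y) / 2) \<in> \<Gamma>"
    using assms(2) by (simp only: opposite_vertices_def)
  then show "(y + x) / 2 + cis (pi / real n) ^ k * ((y - x) / 2) \<in> \<Gamma>"
    using assms(1) by (simp add: power_add cis_pi_div_power field_simps)
qed

lemma closed_opposite_vertices:
  assumes "closed \<Gamma>"
  shows "closed {(x, y). opposite_vertices \<Gamma> n D x y}"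
proof -
  let ?w = "cis (pi / real n)"
  have "{(x, y). opposite_vertices \<Gamma> n D x y}
      = {z. norm (fst z - snd z) = 2 * D / norm (?w - 1)}
        \<inter> (\<Inter>k. (\<lambda>z. (fst z + snd z) / 2 + ?w ^ k * ((fst z - snd z) / 2)) -` \<Gamma>)"
    by (auto simp: opposite_vertices_def)
  also have "closed \<dots>"
    by (intro closed_Int closed_INT ballI closed_vimage assms closed_Collect_eq continuous_intros)
      auto
  finally show ?thesis .
qed

lemma regular_polygon_even_iff:
  assumes "n > 0"
  shows "regular_polygon (2 * n) D S \<longleftrightarrow>
    (\<exists>c v. v \<noteq> 0 \<and> S = (\<lambda>k. c + v * cis (pi / real n) ^ k) ` {..<2 * n}
      \<and> norm v * norm (cis (pi / real n) - 1) = D)"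
proof -
  have "cis (2 * pi * real k / real (2 * n)) = cis (pi / real n) ^ k" for k
    using assms by (simp add: Complex.DeMoivre field_simps)
  moreover have "norm (v * cis (2 * pi / real (2 * n)) - v) = norm v * norm (cis (pi / real n) - 1)"
    for v using assms by (simp add: right_diff_distrib flip: norm_mult)
  ultimately show ?thesis unfolding regular_polygon_def by simp
qed

lemma antipodal_if_dist_twice_radius:
  fixes a b :: "'a::real_inner"
  assumes "norm a = r" "norm b = r" "norm (a - b) = 2 * r"
  shows "a + b = 0"
proof -
  have "(norm (a + b))\<^sup>2 = 2 * (norm a)\<^sup>2 + 2 * (norm b)\<^sup>2 - (norm (a - b))\<^sup>2"
    by (simp add: power2_norm_eq_inner inner_simps inner_commute)
  also have "\<dots> = 0" using assms by (simp add: power2_eq_square)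
  finally show ?thesis by simp
qed

text \<open>
  A vertex of the polygon is as far from \<open>x\<close> as the diameter only if it is opposite to \<open>x\<close>; so
  the vertex set determines the opposite vertex, although the centre and the labelling are not
  part of the polygon.
\<close>

lemma unique_opposite_vertex:
  assumes n: "n \<ge> 2" and D: "D > 0" and poly: "property_C_polygon (2 * n) D \<Gamma>" and x: "x \<in> \<Gamma>"
  shows "\<exists>!y. y \<in> \<Gamma> \<and> opposite_vertices \<Gamma> n D x y"
proof -
  define w where "w = cis (pi / real n)"
  have n0: "n > 0" using n by simp
  have wn: "w ^ n = -1" and w1: "w \<noteq> 1"
    using cis_pi_div_power[OF n0] Im_cis_pi_div_pos[OF n] by (auto simp: w_def)
  have norm_w: "norm (w ^ k) = 1" for k by (simp add: w_def norm_power)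
  have w2n: "w ^ (2 * n) = 1" using wn by (simp add: power_mult mult.commute[of 2])
  have wmod: "w ^ (k mod (2 * n)) = w ^ k" for k
  proof -
    have "w ^ k = w ^ (2 * n * (k div (2 * n)) + k mod (2 * n))" by simp
    also have "\<dots> = w ^ (k mod (2 * n))" unfolding power_add power_mult[of w "2 * n"] w2n by simp
    finally show ?thesis ..
  qed
  note polygon = regular_polygon_even_iff[OF n0, folded w_def]
  note opp = opposite_vertices_def[of \<Gamma> n D, folded w_def]
  have "\<exists>y. opposite_vertices \<Gamma> n D x y"
  proof -
    obtain S where S: "regular_polygon (2 * n) D S" "S \<subseteq> \<Gamma>" "x \<in> S"
      using poly x unfolding property_C_polygon_def inscribed_at_def by blast
    then obtain c v where cv: "S = (\<lambda>k. c + v * w ^ k) ` {..<2 * n}" "norm v * norm (w - 1) = D"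
      unfolding polygon by blast
    then obtain k where k: "x = c + v * w ^ k" using S(3) by blast
    have on: "c + v * w ^ j \<in> \<Gamma>" for j
    proof -
      have "c + v * w ^ (j mod (2 * n)) \<in> S" unfolding cv(1) using n0 by auto
      then show ?thesis using S(2) wmod by auto
    qed
    have "opposite_vertices \<Gamma> n D x (c - v * w ^ k)"
      unfolding opp
    proof (intro conjI allI)
      show "norm (x - (c - v * w ^ k)) = 2 * D / norm (w - 1)"
        using cv(2) w1 norm_w by (simp add: k norm_mult field_simps flip: mult_2)
    next
      fix j
      show "(x + (c - v * w ^ k)) / 2 + w ^ j * ((x - (c - v * w ^ k)) / 2) \<in> \<Gamma>"
        using on[of "j + k"] by (simp add: k power_add algebra_simps)
    qed
    then show ?thesis ..
  qed
  moreover have "y \<in> \<Gamma>" if "opposite_vertices \<Gamma> n D x y" for y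
  proof -
    have "(x + y) / 2 + w ^ n * ((x - y) / 2) \<in> \<Gamma>" using that unfolding opp by blast
    then show ?thesis by (simp add: wn field_simps)
  qed
  moreover have "y = y'"
    if y: "opposite_vertices \<Gamma> n D x y" and y': "opposite_vertices \<Gamma> n D x y'" for y y'
  proof -
    define S where "S z = (\<lambda>k. (x + z) / 2 + ((x - z) / 2) * w ^ k) ` {..<2 * n}" for z
    have S: "regular_polygon (2 * n) D (S z) \<and> inscribed_at (S z) \<Gamma> x"
      if z: "opposite_vertices \<Gamma> n D x z" for z
    proof
      have "norm ((x - z) / 2) * norm (w - 1) = D" "x \<noteq> z"
        using z w1 D by (auto simp: opp norm_divide)
      then show "regular_polygon (2 * n) D (S z)" unfolding polygon S_def
        by (intro exI[of _ "(x + z) / 2"] exI[of _ "(x - z) / 2"]) simp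
      have "(x + z) / 2 + ((x - z) / 2) * w ^ 0 = x" by (simp add: field_simps)
      then have "x \<in> S z" unfolding S_def using n0
        by (intro image_eqI[of _ _ 0]) auto
      then show "inscribed_at (S z) \<Gamma> x"
        using z by (auto simp: inscribed_at_def S_def opp mult.commute)
    qed
    have "S y = S y'" using S[OF y] S[OF y'] poly x unfolding property_C_polygon_def by blast
    moreover have "y \<in> S y" unfolding S_def using n0
      by (intro image_eqI[of _ _ n]) (auto simp: wn field_simps)
    ultimately obtain j where j: "y = (x + y') / 2 + ((x - y') / 2) * w ^ j"
      unfolding S_def by blast
    define r where "r = D / norm (w - 1)"
    \<comment> \<open>The two summands are \<open>x\<close> and \<open>y\<close> relative to the centre \<open>(x + y') / 2\<close>.\<close>
    have "(x - y') / 2 + (x - y') / 2 * w ^ j = 0"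
    proof (rule antipodal_if_dist_twice_radius[of _ r])
      show r': "norm ((x - y') / 2) = r"
        using y' by (simp add: opp r_def norm_divide)
      then show "norm ((x - y') / 2 * w ^ j) = r" by (simp add: norm_mult norm_w)
      have "(x - y') / 2 - (x - y') / 2 * w ^ j = x - y" by (subst j) (simp add: field_simps)
      then show "norm ((x - y') / 2 - (x - y') / 2 * w ^ j) = 2 * r"
        using y by (simp add: opp r_def)
    qed
    then show "y = y'" by (subst j) (simp add: field_simps add_eq_0_iff2)
  qed
  ultimately show ?thesis by blast
qed


section \<open>Chords between farthest points\<close>

lemma property_C_dist_le:
  assumes "property_C R \<Gamma>" "x \<in> \<Gamma>" "z \<in> \<Gamma>"
  shows "norm (x - z) \<le> R"
  using assms unfolding property_C_def by (metis less_eq_real_def)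

lemma property_C_unique_antipode:
  assumes "property_C R \<Gamma>" "x \<in> \<Gamma>"
  shows "\<exists>!y. y \<in> \<Gamma> \<and> norm (x - y) = R"
  using assms unfolding property_C_def by (metis less_irrefl)

lemma velocity_orthogonal_at_farthest_point:
  fixes g :: "real \<Rightarrow> 'a::real_inner"
  assumes g: "(g has_vector_derivative g') (at t)"
    and farthest: "\<And>u. norm (g u - p) \<le> norm (g t - p)"
  shows "g' \<bullet> (g t - p) = 0"
proof -
  have "((\<lambda>u. (g u - p) \<bullet> (g u - p)) has_derivative
      (\<lambda>h. (g t - p) \<bullet> (h *\<^sub>R g') + (h *\<^sub>R g') \<bullet> (g t - p))) (at t)"
    using g unfolding has_vector_derivative_def by (auto intro!: derivative_eq_intros)
  moreover have "(g u - p) \<bullet> (g u - p) \<le> (g t - p) \<bullet> (g t - p)" for u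
    using farthest[of u] by (simp add: norm_le)
  ultimately have "(\<lambda>h. (g t - p) \<bullet> (h *\<^sub>R g') + (h *\<^sub>R g') \<bullet> (g t - p)) = (\<lambda>h. 0)"
    by (intro differential_zero_maxmin[of t UNIV]) auto
  then show ?thesis by (auto simp: inner_commute dest: fun_cong[of _ _ 1])
qed

text \<open>
  In the plane a normal of prescribed length is determined up to sign by the direction of the
  tangent, and continuity fixes the sign; so the normal is as smooth as the tangent.
\<close>

lemma continuous_normal_differentiable:
  fixes U g :: "real \<Rightarrow> complex"
  assumes R: "R > 0" and g: "\<And>t. g differentiable at t" "\<And>t. g t \<noteq> 0"
    and U: "continuous_on UNIV U" "\<And>t. norm (U t) = R" "\<And>t. g t \<bullet> U t = 0"
  shows "U differentiable at t"
proof -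
  \<comment> \<open>\<open>\<i> * g t\<close> is the tangent turned by a right angle, so the normal \<open>U t\<close> is a real multiple of it.\<close>
  define q where "q t = U t / (\<i> * g t)" for t
  have q_real: "q t = of_real (Re (q t))" for t
  proof -
    have "Im (q t) = 0"
      using U(3)[of t] by (simp add: q_def Im_divide inner_complex_def algebra_simps)
    then show ?thesis by (simp add: complex_eq_iff)
  qed
  have U_q: "U t = q t * (\<i> * g t)" for t using g(2)[of t] by (simp add: q_def)
  have abs_q: "\<bar>Re (q t)\<bar> = R / norm (g t)" for t
  proof -
    have "norm (q t) = R / norm (g t)" by (simp add: q_def norm_divide norm_mult U(2))
    then show ?thesis by (subst (asm) q_real) simp
  qed
  have "continuous_on UNIV g"
    using g(1) by (meson continuous_at_imp_continuous_on differentiable_imp_continuous_within)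
  then have "continuous_on UNIV (\<lambda>t. Re (q t))"
    unfolding q_def using U(1) g(2) by (intro continuous_intros) auto
  then have conn: "connected (range (\<lambda>t. Re (q t)))"
    using connected_UNIV connected_continuous_image by blast
  have nz: "Re (q t) \<noteq> 0" for t using abs_q[of t] R g(2)[of t] by auto
  then have "\<not> (Re (q a) \<le> 0 \<and> 0 \<le> Re (q b))" for a b
    using connectedD_interval[OF conn, of "Re (q a)" "Re (q b)" 0] by auto
  then have "(\<forall>t. Re (q t) < 0) \<or> (\<forall>t. Re (q t) > 0)" by (meson not_less)
  then obtain e :: real where e: "\<And>t. Re (q t) = e * (R / norm (g t))"
  proof
    assume "\<forall>t. Re (q t) < 0"
    then have "Re (q t) = (- 1) * (R / norm (g t))" for t using abs_q[of t] by (simp add: abs_if)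
    then show ?thesis using that by blast
  next
    assume "\<forall>t. Re (q t) > 0"
    then have "Re (q t) = 1 * (R / norm (g t))" for t using abs_q[of t] by (simp add: abs_of_pos)
    then show ?thesis using that by blast
  qed
  have "U = (\<lambda>t. (e * (R / norm (g t))) *\<^sub>R (\<i> * g t))"
    by (rule ext, subst U_q, subst q_real, subst e) (simp add: scaleR_conv_of_real)
  moreover have "(\<lambda>t. norm (g t)) differentiable at t"
    using differentiable_compose[OF differentiable_norm_at[OF g(2)] g(1)] by simp
  then have "(\<lambda>t. (e * (R / norm (g t))) *\<^sub>R (\<i> * g t)) differentiable at t"
    using g by (intro differentiable_scaleR differentiable_mult differentiable_divide) auto
  ultimately show ?thesis by simp
qed

lemma inner_mult_mult_complex:
  fixes a x y :: complex
  shows "(a * x) \<bullet> (a * y) = (norm a)\<^sup>2 * (x \<bullet> y)"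
  unfolding cmod_power2 by (simp add: inner_complex_def power2_eq_square algebra_simps)

lemma complex_orthogonal_two_directions:
  fixes a u w :: complex
  assumes "a \<bullet> u = 0" "a \<bullet> (w * u) = 0" "u \<noteq> 0" "Im w \<noteq> 0"
  shows "a = 0"
proof -
  \<comment> \<open>The inner product of \<open>a\<close> and \<open>b\<close> is the real part of \<open>a * cnj b\<close>.\<close>
  have "Re (a * cnj u) = 0" using assms(1) by (simp add: inner_complex_def)
  moreover have "Re (a * cnj u * cnj w) = 0"
    using assms(2) by (simp add: inner_complex_def algebra_simps)
  then have "Im (a * cnj u) * Im w = 0" using calculation by simp
  ultimately have "a * cnj u = 0" using assms(4) by (simp add: complex_eq_iff)
  then show ?thesis using assms(3) by simp
qed

text \<open>
  The line through the centre and a point \<open>p\<close> of the circle has points of \<open>\<Gamma>\<close> on both sides, or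
  on it, by symmetry. By connectedness \<open>\<Gamma>\<close> meets the line, and it can do so only at \<open>p\<close> or at the
  point opposite to \<open>p\<close>.
\<close>

lemma symmetric_connected_subset_sphere:
  fixes c :: complex
  assumes r: "r > 0" and sub: "\<Gamma> \<subseteq> sphere c r" and conn: "connected \<Gamma>" and ne: "\<Gamma> \<noteq> {}"
    and sym: "\<And>x. x \<in> \<Gamma> \<Longrightarrow> 2 * c - x \<in> \<Gamma>"
  shows "\<Gamma> = sphere c r"
proof
  show "sphere c r \<subseteq> \<Gamma>"
  proof
    fix p assume p: "p \<in> sphere c r"
    \<comment> \<open>The sign of \<open>h\<close> tells the sides of the line through \<open>c\<close> and \<open>p\<close> apart.\<close>
    define h where "h x = Im ((x - c) / (p - c))" for x
    have pc: "norm (p - c) = r" "p \<noteq> c" using p r by (auto simp: dist_norm norm_minus_commute)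
    obtain x where x: "x \<in> \<Gamma>" using ne by blast
    have "connected (h ` \<Gamma>)"
      unfolding h_def using pc by (intro connected_continuous_image conn continuous_intros) auto
    moreover have "h (2 * c - x) = - h x" unfolding h_def by (simp add: diff_divide_distrib)
    then have "h x \<in> h ` \<Gamma>" "- h x \<in> h ` \<Gamma>" using x sym by (metis imageI)+
    ultimately have "0 \<in> h ` \<Gamma>"
      using connectedD_interval[of "h ` \<Gamma>" "h x" "- h x" 0]
        connectedD_interval[of "h ` \<Gamma>" "- h x" "h x" 0] by linarith
    then obtain z where z: "z \<in> \<Gamma>" "h z = 0" by auto
    define a where "a = (z - c) / (p - c)"
    have "norm (z - c) = r" using z(1) sub by (auto simp: dist_norm norm_minus_commute)
    then have "norm a = 1" using pc r by (simp add: a_def norm_divide)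
    moreover have a_real: "a = of_real (Re a)" using z(2) by (simp add: h_def a_def complex_eq_iff)
    ultimately have "\<bar>Re a\<bar> = 1" by (metis norm_of_real)
    then have "a = 1 \<or> a = -1" using a_real by (auto simp: abs_if complex_eq_iff split: if_splits)
    then have "p = z \<or> p = 2 * c - z" using pc(2) by (auto simp: a_def field_simps)
    then show "p \<in> \<Gamma>" using z sym by blast
  qed
qed (rule sub)

section \<open>The circle\<close>

theorem corollary4:
  fixes n :: nat and R D :: real and \<Gamma> :: "complex set"
  assumes "n \<ge> 2"
    and "C2_regular_simple_closed_curve \<Gamma>"
    and "R > 0" and "D > 0"
    and "property_C R \<Gamma>"
    and "property_C_polygon (2 * n) D \<Gamma>"
  shows "is_circle \<Gamma>"
proof -
  obtain \<gamma> :: "real \<Rightarrow> complex" and T where T: "T > 0" and per: "\<And>t. \<gamma> (t + T) = \<gamma> t"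
    and C1: "\<gamma> C1_differentiable_on UNIV"
    and C2: "(\<lambda>t. vector_derivative \<gamma> (at t)) C1_differentiable_on UNIV"
    and regular: "\<And>t. vector_derivative \<gamma> (at t) \<noteq> 0"
    and inj: "inj_on \<gamma> {0..<T}" and \<Gamma>: "\<Gamma> = range \<gamma>"
    using assms(2) unfolding C2_regular_simple_closed_curve_def by blast
  have on_\<Gamma>: "\<gamma> t \<in> \<Gamma>" for t using \<Gamma> by blast
  have \<gamma>': "(\<gamma> has_vector_derivative vector_derivative \<gamma> (at t)) (at t)" for t
    using C1 by (simp add: C1_differentiable_on_eq vector_derivative_works)
  have cont: "continuous_on UNIV \<gamma>"
    using \<gamma>' has_vector_derivative_continuous continuous_at_imp_continuous_on by blast
  have "\<Gamma> \<subseteq> \<gamma> ` {0..T}"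
  proof
    fix p assume p: "p \<in> \<Gamma>"
    obtain s where "0 \<le> s" "s < 0 + T" "\<gamma> s = p"
      using periodic_attains_on_period[OF T per p[unfolded \<Gamma>]] by blast
    then show "p \<in> \<gamma> ` {0..T}" by force
  qed
  then have "\<gamma> ` {0..T} = \<Gamma>" using on_\<Gamma> by auto
  moreover have "compact (\<gamma> ` {0..T})"
    by (intro compact_continuous_image continuous_on_subset[OF cont]) auto
  ultimately have "compact \<Gamma>" by simp
  then have closed: "closed \<Gamma>" by (rule compact_imp_closed)
  have conn: "connected \<Gamma>"
    unfolding \<Gamma> using cont by (intro connected_continuous_image) auto
  define w where "w = cis (pi / real n)"
  define d where "d = 2 * D / norm (w - 1)"
  have w: "Im w > 0" using Im_cis_pi_div_pos[OF assms(1)] by (simp add: w_def)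
  then have "w \<noteq> 1" by auto
  then have "d > 0" using assms(4) by (simp add: d_def)

  obtain f where f: "continuous_on UNIV f" "\<And>t. f (f t) = t + T"
    and f_antipode: "\<And>t. norm (\<gamma> t - \<gamma> (f t)) = R"
  proof (rule lift_of_closed_pairing[OF T per inj cont, of "\<lambda>x y. norm (x - y) = R"])
    have "closed {z :: complex \<times> complex. norm (fst z - snd z) = R}"
      by (intro closed_Collect_eq continuous_intros)
    then show "closed {(x :: complex, y). norm (x - y) = R}" by (simp add: case_prod_beta')
    show "\<exists>!y. y \<in> range \<gamma> \<and> norm (x - y) = R" if "x \<in> range \<gamma>" for x
      using property_C_unique_antipode[OF assms(5)] that \<Gamma> by simp
    show "norm (y - x) = R" if "norm (x - y) = R" for x y :: complex
      using that by (simp add: norm_minus_commute)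
  qed (use assms(3) in simp_all)
  obtain g where g: "continuous_on UNIV g" "\<And>t. g (g t) = t + T"
    and g_opposite: "\<And>t. opposite_vertices \<Gamma> n D (\<gamma> t) (\<gamma> (g t))"
  proof (rule lift_of_closed_pairing[OF T per inj cont, of "opposite_vertices \<Gamma> n D"])
    show "closed {(x, y). opposite_vertices \<Gamma> n D x y}"
      by (rule closed_opposite_vertices[OF closed])
    show "opposite_vertices \<Gamma> n D y x" if "opposite_vertices \<Gamma> n D x y" for x y
      using opposite_vertices_sym that assms(1) by simp
    show "\<not> opposite_vertices \<Gamma> n D x x" for x
      using \<open>d > 0\<close> by (auto simp: opposite_vertices_def d_def w_def)
    show "\<exists>!y. y \<in> range \<gamma> \<and> opposite_vertices \<Gamma> n D x y" if "x \<in> range \<gamma>" for x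
      using unique_opposite_vertex[OF assms(1,4,6)] that \<Gamma> by simp
  qed auto
  have g_dist: "norm (\<gamma> t - \<gamma> (g t)) = d" for t
    using g_opposite[of t] by (simp add: opposite_vertices_def d_def w_def)
  obtain t\<^sub>0 where "f t\<^sub>0 = g t\<^sub>0" using half_period_lifts_meet[OF T f g] by blast
  then have "d = R" using f_antipode[of t\<^sub>0] g_dist[of t\<^sub>0] by simp
  then have opposite_antipode: "\<gamma> (g t) = \<gamma> (f t)" for t
    using property_C_unique_antipode[OF assms(5) on_\<Gamma>[of t]] g_dist[of t] f_antipode[of t]
      on_\<Gamma>[of "f t"] on_\<Gamma>[of "g t"] by auto

  \<comment> \<open>\<open>U t\<close> is the diagonal of the polygon at \<open>\<gamma> t\<close>, and \<open>c t\<close> is its centre.\<close>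
  define U where "U t = \<gamma> t - \<gamma> (f t)" for t
  define c where "c t = \<gamma> t - U t / 2" for t
  have U_norm: "norm (U t) = R" for t using f_antipode by (simp add: U_def)
  have vertex: "c t + w ^ k * U t / 2 \<in> \<Gamma>" for t k
  proof -
    have "(\<gamma> t + \<gamma> (f t)) / 2 + w ^ k * ((\<gamma> t - \<gamma> (f t)) / 2) \<in> \<Gamma>"
      using g_opposite[of t] by (simp add: opposite_vertices_def opposite_antipode w_def)
    then show ?thesis by (simp add: c_def U_def field_simps)
  qed
  have opposite_vertex: "c t - w ^ k * U t / 2 \<in> \<Gamma>" for t k
    using vertex[of t "k + n"] cis_pi_div_power[of n] assms(1) by (simp add: power_add w_def)
  have normal_U: "vector_derivative \<gamma> (at t) \<bullet> U t = 0" for t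
    unfolding U_def
  proof (rule velocity_orthogonal_at_farthest_point[OF \<gamma>'])
    show "norm (\<gamma> u - \<gamma> (f t)) \<le> norm (\<gamma> t - \<gamma> (f t))" for u
      using property_C_dist_le[OF assms(5) on_\<Gamma> on_\<Gamma>] by (simp add: f_antipode)
  qed
  have "continuous_on UNIV (\<lambda>t. \<gamma> (f t))"
    using continuous_on_compose2[OF cont f(1)] by simp
  then have cont_U: "continuous_on UNIV U"
    unfolding U_def by (intro continuous_on_diff cont)
  have U_diff: "U differentiable at t" for t
  proof (rule continuous_normal_differentiable[OF assms(3) _ regular cont_U U_norm normal_U])
    show "(\<lambda>t. vector_derivative \<gamma> (at t)) differentiable at s" for s
      using C2 by (simp add: C1_differentiable_on_eq)
  qed
  have c'_zero: "(c has_vector_derivative 0) (at t)" for t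
  proof -
    obtain u' where u': "(U has_vector_derivative u') (at t)"
      using U_diff vector_derivative_works by blast
    define c' where "c' = vector_derivative \<gamma> (at t) - u' / 2"
    have c': "(c has_vector_derivative c') (at t)"
      unfolding c_def c'_def by (intro derivative_intros \<gamma>' u')
    \<comment> \<open>A curve of constant norm is everywhere at maximal distance from the origin.\<close>
    have "u' \<bullet> (U t - 0) = 0"
      by (intro velocity_orthogonal_at_farthest_point[OF u']) (simp add: U_norm)
    then have U_u': "u' \<bullet> U t = 0" by simp
    \<comment> \<open>The moving vertex \<open>z\<close> is compared with its opposite vertex \<open>p\<close> held fixed at time \<open>t\<close>.\<close>
    have normal: "c' \<bullet> (w ^ k * U t) = 0" for k
    proof -
      define z where "z s = c s + w ^ k * U s / 2" for s
      define p where "p = c t - w ^ k * U t / 2"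
      have z': "(z has_vector_derivative c' + w ^ k * u' / 2) (at t)"
        unfolding z_def by (intro derivative_intros c' u')
      have z_p: "z t - p = w ^ k * U t" by (simp add: z_def p_def field_simps)
      have norm_w: "norm (w ^ k) = 1" by (simp add: w_def norm_power)
      have "norm (z s - p) \<le> R" for s
        unfolding z_def p_def by (rule property_C_dist_le[OF assms(5) vertex opposite_vertex])
      then have "(c' + w ^ k * u' / 2) \<bullet> (z t - p) = 0"
        by (intro velocity_orthogonal_at_farthest_point[OF z'])
          (simp add: z_p norm_mult norm_w U_norm)
      moreover have "(u' / 2) \<bullet> U t = 0"
        using U_u' by (simp add: inner_complex_def flip: add_divide_distrib)
      then have "(w ^ k * u' / 2) \<bullet> (w ^ k * U t) = 0"
        using inner_mult_mult_complex[of "w ^ k" "u' / 2" "U t"] by simp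
      ultimately show ?thesis unfolding z_p by (simp add: inner_add_left)
    qed
    have "c' = 0"
      using normal[of 0] normal[of 1] w U_norm[of t] assms(3)
      by (intro complex_orthogonal_two_directions[of c' "U t" w]) auto
    then show ?thesis using c' by simp
  qed
  then obtain c0 where c0: "\<And>t. c t = c0"
    using has_vector_derivative_zero_constant[of UNIV c] by auto
  have "\<Gamma> = sphere c0 (R / 2)"
  proof (rule symmetric_connected_subset_sphere[OF _ _ conn])
    show "R / 2 > 0" using assms(3) by simp
    show "\<Gamma> \<noteq> {}" using \<Gamma> by simp
    have \<gamma>_eq: "\<gamma> t = c0 + U t / 2" for t using c0[of t] by (simp add: c_def diff_eq_eq)
    then have "norm (\<gamma> t - c0) = R / 2" for t by (simp add: norm_divide U_norm)
    then show "\<Gamma> \<subseteq> sphere c0 (R / 2)"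
      unfolding \<Gamma> by (auto simp: dist_norm norm_minus_commute)
    have "2 * c0 - \<gamma> t = \<gamma> (f t)" for t using \<gamma>_eq[of t] by (simp add: U_def field_simps)
    then show "2 * c0 - x \<in> \<Gamma>" if "x \<in> \<Gamma>" for x using that \<Gamma> by auto
  qed
  then show ?thesis unfolding is_circle_def using assms(3) half_gt_zero by blast
qed

end
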